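(* Let $$\mathbf p^{(2)}(\theta)=\begin{bmatrix}1+e^{-\iota\theta}&e^{\iota\theta}+1\\2e^{-\iota\theta}&2\end{bmatrix},\qquad \mathbf p^{(4)}(\theta_1,\theta_2)=\mathbf p^{(2)}(\theta_1)\otimes\mathbf p^{(2)}(\theta_2),$$ and let $$\mathbf f_A(\theta_1,\theta_2)=-\frac13\begin{bmatrix}-8&1+e^{-\iota\theta_1}&1+e^{-\iota\theta_2}&\varphi(-\theta_1,-\theta_2)\\1+e^{\iota\theta_1}&-8&\varphi(\theta_1,-\theta_2)&1+e^{-\iota\theta_2}\\1+e^{\iota\theta_2}&\varphi(-\theta_1,\theta_2)&-8&1+e^{-\iota\theta_1}\\\varphi(\theta_1,\theta_2)&1+e^{\iota\theta_2}&1+e^{\iota\theta_1}&-8\end{bmatrix},$$ where $\varphi(\theta_1,\theta_2)=1+e^{\iota\theta_1}+e^{\iota\theta_2}+e^{\iota(\theta_1+\theta_2)}$. For $\boldsymbol\theta=(\theta_1,\theta_2)$ let $\Omega(\boldsymbol\theta)=\{(\theta_1,\theta_2),(\theta_1+\pi,\theta_2),(\theta_1,\theta_2+\pi),(\theta_1+\pi,\theta_2+\pi)\}$, and let $\boldsymbol\theta_0=(0,0)$, $\mathbf e_4=[1,1,1,1]^T$. Then: (i) $\displaystyle\sum_{\xi\in\Omega(\boldsymbol\theta)}\mathbf p^{(4)}(\xi)^H\mathbf p^{(4)}(\xi)$ is positive definite for all $\boldsymbol\theta\in[0,2\pi)^2$. (ii) The function $$\mathbf s^{(4)}(\boldsymbol\theta)=\mathbf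 p^{(4)}(\boldsymbol\theta)\left(\sum_{\xi\in\Omega(\boldsymbol\theta)}\mathbf p^{(4)}(\xi)^H\mathbf p^{(4)}(\xi)\right)^{-1}\mathbf p^{(4)}(\boldsymbol\theta)^H$$ is well defined for all $\boldsymbol\theta\in[0,2\pi)^2$, and $\mathbf s^{(4)}(\boldsymbol\theta_0)\mathbf e_4=\mathbf e_4$. (iii) There is a constant $c\in\mathbb R$ such that $$\lim_{\boldsymbol\theta\to\boldsymbol\theta_0}\big(\lambda_1(\mathbf f_A(\boldsymbol\theta))\big)^{-1}\big(1-\lambda_1(\mathbf s^{(4)}(\boldsymbol\theta))\big)=c,$$ where $\lambda_1(\mathbf f_A(\boldsymbol\theta))$ is the minimal eigenvalue of $\mathbf f_A(\boldsymbol\theta)$ and $\lambda_1(\mathbf s^{(4)}(\boldsymbol\theta))$ is the eigenvalue function of $\mathbf s^{(4)}$ that takes the value $1$ at $\boldsymbol\theta_0$, i.e. the maximal eigenvalue of $\mathbf s^{(4)}(\boldsymbol\theta)$.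
   Context: $\iota$ is the imaginary unit, $\otimes$ the Kronecker product, and ${}^H$ the conjugate transpose. $\mathbf f_A$ and $\mathbf s^{(4)}$ are Hermitian matrix-valued functions, considered as $2\pi$-periodic in each variable; the limit is over $\boldsymbol\theta\ne\boldsymbol\theta_0$. *)

theory Defs
  imports
    Complex_Main
    "Jordan_Normal_Form.Schur_Decomposition"
    "Jordan_Normal_Form.Gauss_Jordan_Elimination"
begin

definition kron :: "'a :: times mat \<Rightarrow> 'a mat \<Rightarrow> 'a mat" where
  "kron A B = mat (dim_row A * dim_row B) (dim_col A * dim_col B)
     (\<lambda>(i, j). A $$ (i div dim_row B, j div dim_col B) * B $$ (i mod dim_row B, j mod dim_col B))"

definition hermitian_mat :: "complex mat \<Rightarrow> bool" where
  "hermitian_mat A \<longleftrightarrow> square_mat A \<and> mat_adjoint A = A"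

definition positive_definite :: "complex mat \<Rightarrow> bool" where
  "positive_definite A \<longleftrightarrow> hermitian_mat A \<and>
     (\<forall>v \<in> carrier_vec (dim_row A). v \<noteq> 0\<^sub>v (dim_row A) \<longrightarrow> 0 < Re ((A *\<^sub>v v) \<bullet>c v))"

text \<open>
  The extreme eigenvalues are only meant for nonempty Hermitian matrices. All eigenvalues
  of such a matrix are real, so the sets below are finite and nonempty and contain the whole spectrum.
\<close>

definition min_eigenvalue :: "complex mat \<Rightarrow> real" where
  "min_eigenvalue A = Min {x. eigenvalue A (complex_of_real x)}"

definition max_eigenvalue :: "complex mat \<Rightarrow> real" where
  "max_eigenvalue A = Max {x. eigenvalue A (complex_of_real x)}"

definition p2 :: "real \<Rightarrow> complex mat" where
  "p2 \<theta> = mat_of_rows_list 2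
     [[1 + exp (- \<i> * \<theta>), exp (\<i> * \<theta>) + 1],
      [2 * exp (- \<i> * \<theta>), 2]]"

definition p4 :: "real \<times> real \<Rightarrow> complex mat" where
  "p4 \<theta> = kron (p2 (fst \<theta>)) (p2 (snd \<theta>))"

definition phi :: "real \<Rightarrow> real \<Rightarrow> complex" where
  "phi \<theta>1 \<theta>2 = 1 + exp (\<i> * \<theta>1) + exp (\<i> * \<theta>2) + exp (\<i> * (\<theta>1 + \<theta>2))"

definition f_A :: "real \<times> real \<Rightarrow> complex mat" where
  "f_A = (\<lambda>(\<theta>1, \<theta>2). (- 1 / 3) \<cdot>\<^sub>m mat_of_rows_list 4
     [[- 8, 1 + exp (- \<i> * \<theta>1), 1 + exp (- \<i> * \<theta>2), phi (- \<theta>1) (- \<theta>2)],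
      [1 + exp (\<i> * \<theta>1), - 8, phi \<theta>1 (- \<theta>2), 1 + exp (- \<i> * \<theta>2)],
      [1 + exp (\<i> * \<theta>2), phi (- \<theta>1) \<theta>2, - 8, 1 + exp (- \<i> * \<theta>1)],
      [phi \<theta>1 \<theta>2, 1 + exp (\<i> * \<theta>2), 1 + exp (\<i> * \<theta>1), - 8]])"

definition Omega :: "real \<times> real \<Rightarrow> (real \<times> real) set" where
  "Omega = (\<lambda>(\<theta>1, \<theta>2). {(\<theta>1, \<theta>2), (\<theta>1 + pi, \<theta>2), (\<theta>1, \<theta>2 + pi), (\<theta>1 + pi, \<theta>2 + pi)})"

text \<open>
  The type of matrices of arbitrary dimension has no zero and hence no set-indexed sum,
  so the matrix sum over \<open>Omega \<theta>\<close> is taken entrywise.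
\<close>

definition p4_sum :: "real \<times> real \<Rightarrow> complex mat" where
  "p4_sum \<theta> = mat 4 4 (\<lambda>ij. \<Sum>\<xi>\<in>Omega \<theta>. (mat_adjoint (p4 \<xi>) * p4 \<xi>) $$ ij)"

text \<open>The inverse is meaningful wherever \<open>p4_sum \<theta>\<close> is invertible.\<close>

definition s4 :: "real \<times> real \<Rightarrow> complex mat" where
  "s4 \<theta> = p4 \<theta> * the (mat_inverse (p4_sum \<theta>)) * mat_adjoint (p4 \<theta>)"

definition e4 :: "complex vec" where
  "e4 = vec 4 (\<lambda>_. 1)"

end

theory Submission
  imports Defs "Jordan_Normal_Form.Spectral_Radius"
begin

text \<open>
  The matrix \<open>p2 t\<close> has rank one: it is the column \<open>(1 + exp (i t), 2)\<close> times the row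
  \<open>(exp (- i t), 1)\<close>. Hence \<open>p4 \<theta>\<close> is a column times a row as well, and the four rows
  belonging to \<open>Omega \<theta>\<close> are pairwise orthogonal. So \<open>p4_sum \<theta>\<close> is positive definite with these
  (conjugated) rows as eigenvectors, and \<open>s4 \<theta>\<close> is the orthogonal projection onto the column.
  Its maximal eigenvalue is constantly 1, so the limit exists with \<open>c = 0\<close>. The remaining point is
  that \<open>f_A \<theta>\<close> has a nonzero minimal eigenvalue near the origin; this holds because \<open>f_A \<theta>\<close>
  is strictly diagonally dominant there, except at the origin itself.
\<close>

lemma sum_atLeast0_lessThan_4: "sum g {0..<4} = g 0 + g 1 + g 2 + (g (3::nat) :: 'a::comm_monoid_add)"
  by (simp add: eval_nat_numeral add.assoc)

lemma less_4_cases: "i < 4 \<longleftrightarrow> i = 0 \<or> i = 1 \<or> i = 2 \<or> i = (3::nat)"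
  by auto

lemma mat_adjoint_carrier: "A \<in> carrier_mat n n \<Longrightarrow> mat_adjoint A \<in> carrier_mat n n"
  by (auto simp: mat_adjoint_def)

lemma mat_adjoint_index:
  "i < dim_col A \<Longrightarrow> j < dim_row A \<Longrightarrow> mat_adjoint A $$ (i, j) = conjugate (A $$ (j, i))"
  by (simp add: mat_adjoint_def mat_of_rows_index)

section \<open>Rank-one factorisation of \<open>p2\<close> and \<open>p4\<close>\<close>

definition col2 :: "real \<Rightarrow> nat \<Rightarrow> complex" where
  "col2 t i = (if i = 0 then 1 + exp (\<i> * t) else 2)"

definition row2 :: "real \<Rightarrow> nat \<Rightarrow> complex" where
  "row2 t j = (if j = 0 then exp (- \<i> * t) else 1)"

text \<open>The split of the index by \<open>div\<close> and \<open>mod\<close> is that of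
  \<open>kron\<close>: a Kronecker product of rank-one matrices is the Kronecker product of the
  columns times that of the rows.\<close>

definition col4 :: "real \<times> real \<Rightarrow> complex vec" where
  "col4 \<theta> = vec 4 (\<lambda>i. col2 (fst \<theta>) (i div 2) * col2 (snd \<theta>) (i mod 2))"

definition row4 :: "real \<times> real \<Rightarrow> complex vec" where
  "row4 \<theta> = vec 4 (\<lambda>j. row2 (fst \<theta>) (j div 2) * row2 (snd \<theta>) (j mod 2))"

definition weight :: "real \<times> real \<Rightarrow> real" where
  "weight \<theta> = (\<Sum>i = 0..<4. (cmod (col4 \<theta> $ i))\<^sup>2)"

lemma dim_col4 [simp]: "dim_vec (col4 \<theta>) = 4" and dim_row4 [simp]: "dim_vec (row4 \<theta>) = 4"
  by (simp_all add: col4_def row4_def)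

lemma col4_carrier [simp]: "col4 \<theta> \<in> carrier_vec 4"
  and row4_carrier [simp]: "row4 \<theta> \<in> carrier_vec 4"
  by (simp_all add: carrier_vecI)

lemma col4_scalar_prod: "col4 \<theta> \<bullet>c col4 \<theta> = weight \<theta>"
  by (simp add: scalar_prod_def weight_def complex_norm_square[symmetric] del: of_real_power)

lemma weight_pos: "weight \<theta> > 0"
  unfolding weight_def
  \<comment> \<open>Entry 3 is chosen because it equals 2 * 2 for every angle, whereas the other
    entries can vanish.\<close>
  by (rule sum_pos2[of _ 3]) (auto simp: col4_def col2_def)

lemma p2_carrier: "p2 t \<in> carrier_mat 2 2"
  by (auto simp: p2_def mat_of_rows_list_def)

lemma p2_index:
  assumes "i < 2" "j < 2"
  shows "p2 t $$ (i, j) = col2 t i * row2 t j"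
proof -
  have "i = 0 \<or> i = 1" "j = 0 \<or> j = 1" using assms by auto
  then show ?thesis
    by (auto simp: p2_def mat_of_rows_list_def col2_def row2_def ring_distribs exp_add[symmetric])
qed

lemma p4_carrier [simp]: "p4 \<theta> \<in> carrier_mat 4 4"
  using carrier_matD[OF p2_carrier] by (simp add: p4_def kron_def)

lemma dim_p4 [simp]: "dim_row (p4 \<theta>) = 4" "dim_col (p4 \<theta>) = 4"
  using carrier_matD[OF p4_carrier] by simp_all

lemma dim_mat_adjoint_p4 [simp]:
  "dim_row (mat_adjoint (p4 \<theta>)) = 4" "dim_col (mat_adjoint (p4 \<theta>)) = 4"
  using carrier_matD[OF mat_adjoint_carrier[OF p4_carrier]] by simp_all

lemma p4_index:
  assumes "i < 4" "j < 4"
  shows "p4 \<theta> $$ (i, j) = col4 \<theta> $ i * row4 \<theta> $ j"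
proof -
  have "p4 \<theta> $$ (i, j) = p2 (fst \<theta>) $$ (i div 2, j div 2) * p2 (snd \<theta>) $$ (i mod 2, j mod 2)"
    using assms p2_carrier[of "fst \<theta>"] p2_carrier[of "snd \<theta>"] by (auto simp: p4_def kron_def)
  then show ?thesis
    using assms by (simp add: p2_index col4_def row4_def less_mult_imp_div_less)
qed

lemma p4_mult_vec:
  assumes "v \<in> carrier_vec 4"
  shows "p4 \<theta> *\<^sub>v v = (row4 \<theta> \<bullet> v) \<cdot>\<^sub>v col4 \<theta>"
  using assms
  by (intro eq_vecI) (auto simp: scalar_prod_def p4_index sum_distrib_left mult_ac intro!: sum.cong)

lemma p4_adjoint_mult_vec:
  assumes "v \<in> carrier_vec 4"
  shows "mat_adjoint (p4 \<theta>) *\<^sub>v v = (v \<bullet>c col4 \<theta>) \<cdot>\<^sub>v conjugate (row4 \<theta>)"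
  using assms
  by (intro eq_vecI)
    (auto simp: scalar_prod_def p4_index mat_adjoint_index sum_distrib_left mult_ac intro!: sum.cong)

section \<open>The sum over \<open>Omega\<close> and its positive definiteness\<close>

text \<open>The four points are distinct because pi is nonzero, so the set loses no summand.\<close>

lemma sum_Omega:
  "sum g (Omega (s, t)) = g (s, t) + g (s + pi, t) + g (s, t + pi) + g (s + pi, t + pi)"
  for g :: "real \<times> real \<Rightarrow> 'a::comm_monoid_add"
  by (simp add: Omega_def add.assoc)

lemma finite_Omega [simp]: "finite (Omega \<theta>)"
  by (cases \<theta>) (simp add: Omega_def)

lemma p4_sum_carrier [simp]: "p4_sum \<theta> \<in> carrier_mat 4 4"
  by (simp add: p4_sum_def)

lemma dim_p4_sum [simp]: "dim_row (p4_sum \<theta>) = 4" "dim_col (p4_sum \<theta>) = 4"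
  by (simp_all add: p4_sum_def)

text \<open>In the Gram matrix of a column times a row, the column survives only through its squared
  norm \<open>weight\<close>.\<close>

lemma p4_sum_index:
  assumes "i < 4" "j < 4"
  shows "p4_sum \<theta> $$ (i, j) = (\<Sum>\<xi>\<in>Omega \<theta>. weight \<xi> * cnj (row4 \<xi> $ i) * row4 \<xi> $ j)"
proof -
  have "(mat_adjoint (p4 \<xi>) * p4 \<xi>) $$ (i, j) = weight \<xi> * cnj (row4 \<xi> $ i) * row4 \<xi> $ j" for \<xi>
    using assms
    by (simp add: scalar_prod_def mat_adjoint_index p4_index sum_distrib_left weight_def
        complex_norm_square mult_ac del: of_real_power)
  then show ?thesis
    using assms by (simp add: p4_sum_def)
qed

lemma p4_sum_mult_vec_index:
  assumes "v \<in> carrier_vec 4" "i < 4"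
  shows "(p4_sum \<theta> *\<^sub>v v) $ i = (\<Sum>\<xi>\<in>Omega \<theta>. weight \<xi> * (row4 \<xi> \<bullet> v) * cnj (row4 \<xi> $ i))"
proof -
  have "(p4_sum \<theta> *\<^sub>v v) $ i =
      (\<Sum>j = 0..<4. \<Sum>\<xi>\<in>Omega \<theta>. weight \<xi> * cnj (row4 \<xi> $ i) * row4 \<xi> $ j * v $ j)"
    using assms
    by (simp add: scalar_prod_def p4_sum_index sum_distrib_right)
  also have "\<dots> = (\<Sum>\<xi>\<in>Omega \<theta>. weight \<xi> * (row4 \<xi> \<bullet> v) * cnj (row4 \<xi> $ i))"
    using assms by (subst sum.swap) (simp add: scalar_prod_def sum_distrib_left sum_distrib_right mult_ac)
  finally show ?thesis .
qed

text \<open>Reduces positive definiteness to the claim that no nonzero vector is annihilated by all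
  four rows.\<close>

lemma p4_sum_quadratic_form:
  assumes "v \<in> carrier_vec 4"
  shows "(p4_sum \<theta> *\<^sub>v v) \<bullet>c v = (\<Sum>\<xi>\<in>Omega \<theta>. weight \<xi> * (cmod (row4 \<xi> \<bullet> v))\<^sup>2)"
proof -
  have "(p4_sum \<theta> *\<^sub>v v) \<bullet>c v =
      (\<Sum>i = 0..<4. \<Sum>\<xi>\<in>Omega \<theta>. weight \<xi> * (row4 \<xi> \<bullet> v) * cnj (row4 \<xi> $ i) * cnj (v $ i))"
    using assms by (simp add: scalar_prod_def[of _ "conjugate v"] p4_sum_mult_vec_index sum_distrib_right
        del: index_mult_mat_vec(1))
  also have "\<dots> = (\<Sum>\<xi>\<in>Omega \<theta>. weight \<xi> * ((row4 \<xi> \<bullet> v) * cnj (row4 \<xi> \<bullet> v)))"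
  proof (subst sum.swap, rule sum.cong[OF refl])
    fix \<xi>
    have "cnj (row4 \<xi> \<bullet> v) = (\<Sum>i = 0..<4. cnj (row4 \<xi> $ i) * cnj (v $ i))"
      using assms by (simp add: scalar_prod_def)
    then show "(\<Sum>i = 0..<4. weight \<xi> * (row4 \<xi> \<bullet> v) * cnj (row4 \<xi> $ i) * cnj (v $ i))
        = weight \<xi> * ((row4 \<xi> \<bullet> v) * cnj (row4 \<xi> \<bullet> v))"
      by (simp add: sum_distrib_left mult_ac)
  qed
  finally show ?thesis
    by (simp add: complex_norm_square del: of_real_power)
qed

lemma cnj_exp_i: "cnj (exp (\<i> * complex_of_real t)) = exp (- (\<i> * t))"
  using cis_cnj[of t] by (simp add: cis_conv_exp)

text \<open>Moving to another point of \<open>Omega\<close> only flips signs of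
  exponentials.\<close>

lemma exp_shift_pi: "exp (\<i> * complex_of_real (t + pi)) = - exp (\<i> * t)"
  "exp (- (\<i> * complex_of_real (t + pi))) = - exp (- (\<i> * t))"
  by (simp_all add: exp_add ring_distribs exp_diff exp_minus)

text \<open>After the nonzero exponentials are absorbed into the unknowns, the four rows form a 4 by
  4 Hadamard matrix of signs, which is invertible.\<close>

lemma row4_separates:
  assumes v: "v \<in> carrier_vec 4" and zero: "\<And>\<xi>. \<xi> \<in> Omega \<theta> \<Longrightarrow> row4 \<xi> \<bullet> v = 0"
  shows "v = 0\<^sub>v 4"
proof -
  obtain s t where \<theta>: "\<theta> = (s, t)" by (cases \<theta>)
  define x where "x = exp (- (\<i> * complex_of_real s))"
  define y where "y = exp (- (\<i> * complex_of_real t))"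
  have prod: "row4 (a, b) \<bullet> v = exp (- (\<i> * a)) * exp (- (\<i> * b)) * v $ 0 + exp (- (\<i> * a)) * v $ 1
      + exp (- (\<i> * b)) * v $ 2 + v $ 3" for a b :: real
    using v by (simp add: scalar_prod_def sum_atLeast0_lessThan_4 row4_def row2_def)
  have "x * y * v $ 0 + x * v $ 1 + y * v $ 2 + v $ 3 = 0"
    "- (x * y * v $ 0) - x * v $ 1 + y * v $ 2 + v $ 3 = 0"
    "- (x * y * v $ 0) + x * v $ 1 - y * v $ 2 + v $ 3 = 0"
    "x * y * v $ 0 - x * v $ 1 - y * v $ 2 + v $ 3 = 0"
    using zero[of "(s, t)"] zero[of "(s + pi, t)"] zero[of "(s, t + pi)"] zero[of "(s + pi, t + pi)"]
    unfolding \<theta> Omega_def prod exp_shift_pi x_def y_def by simp_all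
  moreover have "A = 0" "B = 0" "C = 0" "D = 0"
    if *: "A + B + C + D = 0" "- A - B + C + D = 0" "- A + B - C + D = 0" "A - B - C + D = 0"
    for A B C D :: complex
  proof -
    \<comment> \<open>Weighting the four equations by the signs of one column isolates four times
      one unknown, since the columns are orthogonal.\<close>
    have "4 * A = (A + B + C + D) - (- A - B + C + D) - (- A + B - C + D) + (A - B - C + D)"
      "4 * B = (A + B + C + D) - (- A - B + C + D) + (- A + B - C + D) - (A - B - C + D)"
      "4 * C = (A + B + C + D) + (- A - B + C + D) - (- A + B - C + D) - (A - B - C + D)"
      "4 * D = (A + B + C + D) + (- A - B + C + D) + (- A + B - C + D) + (A - B - C + D)"
      by simp_all
    then show "A = 0" "B = 0" "C = 0" "D = 0"
      unfolding * by simp_all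
  qed
  ultimately have "x * y * v $ 0 = 0" "x * v $ 1 = 0" "y * v $ 2 = 0" "v $ 3 = 0"
    by blast+
  then have "v $ 0 = 0" "v $ 1 = 0" "v $ 2 = 0" "v $ 3 = 0"
    by (simp_all add: x_def y_def)
  with v show ?thesis
    by (intro eq_vecI) (auto simp: less_4_cases)
qed

lemma positive_definite_p4_sum: "positive_definite (p4_sum \<theta>)"
  unfolding positive_definite_def hermitian_mat_def
proof (intro conjI ballI impI)
  show "square_mat (p4_sum \<theta>)"
    by (simp add: p4_sum_def)
  show "mat_adjoint (p4_sum \<theta>) = p4_sum \<theta>"
    using mat_adjoint_carrier[OF p4_sum_carrier[of \<theta>]] carrier_matD[OF p4_sum_carrier[of \<theta>]]
    by (intro eq_matI) (auto simp: mat_adjoint_index p4_sum_index mult_ac)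
next
  fix v :: "complex vec"
  assume "v \<in> carrier_vec (dim_row (p4_sum \<theta>))" "v \<noteq> 0\<^sub>v (dim_row (p4_sum \<theta>))"
  then have v: "v \<in> carrier_vec 4" "v \<noteq> 0\<^sub>v 4" by (simp_all add: p4_sum_def)
  then obtain \<xi> where "\<xi> \<in> Omega \<theta>" "row4 \<xi> \<bullet> v \<noteq> 0"
    using row4_separates by blast
  then have "0 < (\<Sum>\<xi>\<in>Omega \<theta>. weight \<xi> * (cmod (row4 \<xi> \<bullet> v))\<^sup>2)"
    by (intro sum_pos2[of _ \<xi>]) (auto simp: weight_pos less_imp_le)
  then show "0 < Re ((p4_sum \<theta> *\<^sub>v v) \<bullet>c v)"
    using v by (simp only: p4_sum_quadratic_form Re_complex_of_real)
qed

text \<open>A kernel vector would make the quadratic form zero, so the determinant is nonzero and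
  \<open>mat_inverse\<close> cannot return \<open>None\<close>. This gives meaning to
  \<open>the\<close> in \<open>s4\<close>.\<close>

lemma positive_definite_mat_inverse:
  assumes A: "A \<in> carrier_mat n n" and pd: "positive_definite A"
  obtains B where "mat_inverse A = Some B" "B \<in> carrier_mat n n" "A * B = 1\<^sub>m n" "B * A = 1\<^sub>m n"
proof (cases "mat_inverse A")
  case None
  have "det A \<noteq> 0"
  proof
    assume "det A = 0"
    then obtain v where "v \<in> carrier_vec n" "v \<noteq> 0\<^sub>v n" "A *\<^sub>v v = 0\<^sub>v n"
      using det_0_iff_vec_prod_zero[OF A] by blast
    with pd A show False
      by (auto simp: positive_definite_def)
  qed
  then have "A \<in> Units (ring_mat TYPE(complex) n ())"
    by (rule det_non_zero_imp_unit[OF A])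
  with mat_inverse(1)[OF A None, of "()"] show thesis by blast
next
  case (Some B)
  with mat_inverse(2)[OF A Some] that show thesis by blast
qed

lemma positive_definite_invertible:
  assumes "A \<in> carrier_mat n n" "positive_definite A"
  shows "invertible_mat A"
  by (rule positive_definite_mat_inverse[OF assms])
    (use assms(1) in \<open>auto simp: invertible_mat_def inverts_mat_def\<close>)

section \<open>Orthogonality of the rows, and \<open>s4\<close> as a projection\<close>

text \<open>The inner product factors over the two variables: an unshifted variable contributes 1 +
  1, a shifted one -1 + 1.\<close>

lemma row4_orthogonal:
  "row4 (s, t) \<bullet>c row4 (s, t) = 4"
  "row4 (s + pi, t) \<bullet>c row4 (s, t) = 0"
  "row4 (s, t + pi) \<bullet>c row4 (s, t) = 0"
  "row4 (s + pi, t + pi) \<bullet>c row4 (s, t) = 0"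
proof -
  have "exp (- (\<i> * complex_of_real a)) * exp (\<i> * a) = 1" for a
    by (simp add: exp_add[symmetric])
  note * = this[of s] this[of t]
  have prod: "row4 (a, b) \<bullet>c row4 (s, t) =
      (exp (- (\<i> * a)) * exp (\<i> * s) + 1) * (exp (- (\<i> * b)) * exp (\<i> * t) + 1)" for a b :: real
    by (simp add: scalar_prod_def sum_atLeast0_lessThan_4 row4_def row2_def cnj_exp_i
        cnj_exp_i[of "- t" for t, simplified] algebra_simps)
  show "row4 (s, t) \<bullet>c row4 (s, t) = 4"
  "row4 (s + pi, t) \<bullet>c row4 (s, t) = 0"
  "row4 (s, t + pi) \<bullet>c row4 (s, t) = 0"
  "row4 (s + pi, t + pi) \<bullet>c row4 (s, t) = 0"
    unfolding prod exp_shift_pi by (simp_all add: *)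
qed

text \<open>By orthogonality only the summand at \<open>\<theta>\<close> itself survives; the 4 is
  the squared norm of the row.\<close>

lemma p4_sum_eigenvector:
  "p4_sum \<theta> *\<^sub>v conjugate (row4 \<theta>) = (4 * complex_of_real (weight \<theta>)) \<cdot>\<^sub>v conjugate (row4 \<theta>)"
proof (cases \<theta>)
  case (Pair s t)
  then show ?thesis
    by (intro eq_vecI) (simp_all add: p4_sum_mult_vec_index sum_Omega row4_orthogonal
        del: index_mult_mat_vec(1))
qed

lemma s4_carrier: "s4 \<theta> \<in> carrier_mat 4 4"
  by (rule positive_definite_mat_inverse[OF p4_sum_carrier positive_definite_p4_sum, of \<theta>])
    (simp add: s4_def mult_carrier_mat[of _ 4 4 _ 4] mat_adjoint_carrier)

text \<open>The adjoint of \<open>p4\<close> sends \<open>v\<close> to a multiple of the conjugated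
  row. This is an eigenvector of \<open>p4_sum\<close>, so the inverse only rescales it, and
  \<open>p4\<close> then returns a multiple of the column. The squared norm 4 of the row cancels,
  which leaves the orthogonal projection.\<close>

lemma s4_mult_vec:
  assumes v: "v \<in> carrier_vec 4"
  shows "s4 \<theta> *\<^sub>v v = ((v \<bullet>c col4 \<theta>) / weight \<theta>) \<cdot>\<^sub>v col4 \<theta>"
proof -
  let ?w = "conjugate (row4 \<theta>)" and ?c = "4 * complex_of_real (weight \<theta>)"
  obtain B where B: "mat_inverse (p4_sum \<theta>) = Some B" "B \<in> carrier_mat 4 4" "B * p4_sum \<theta> = 1\<^sub>m 4"
    by (rule positive_definite_mat_inverse[OF p4_sum_carrier positive_definite_p4_sum])
  have w: "?w \<in> carrier_vec 4" by simp
  have "?w = B *\<^sub>v (p4_sum \<theta> *\<^sub>v ?w)"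
    using B w by (metis assoc_mult_mat_vec one_mult_mat_vec p4_sum_carrier)
  also have "\<dots> = ?c \<cdot>\<^sub>v (B *\<^sub>v ?w)"
    using B w by (simp add: p4_sum_eigenvector mult_mat_vec)
  finally have "(1 / ?c) \<cdot>\<^sub>v ?w = (1 / ?c) \<cdot>\<^sub>v (?c \<cdot>\<^sub>v (B *\<^sub>v ?w))"
    by simp
  then have Bw: "B *\<^sub>v ?w = (1 / ?c) \<cdot>\<^sub>v ?w"
    using weight_pos[of \<theta>] by (simp add: smult_smult_assoc)
  have "s4 \<theta> *\<^sub>v v = p4 \<theta> *\<^sub>v (B *\<^sub>v (mat_adjoint (p4 \<theta>) *\<^sub>v v))"
    using B v mat_adjoint_carrier[OF p4_carrier[of \<theta>]]
    by (simp add: s4_def assoc_mult_mat_vec[of _ 4 4 _ 4] mult_mat_vec_carrier[of _ 4 4]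
        mult_carrier_mat[of _ 4 4 _ 4])
  also have "\<dots> = ((v \<bullet>c col4 \<theta>) * (1 / ?c)) \<cdot>\<^sub>v (p4 \<theta> *\<^sub>v ?w)"
    using B v w by (simp add: p4_adjoint_mult_vec mult_mat_vec mult_mat_vec[OF p4_carrier] Bw smult_smult_assoc)
  also have "\<dots> = ((v \<bullet>c col4 \<theta>) / weight \<theta>) \<cdot>\<^sub>v col4 \<theta>"
    using row4_orthogonal(1)[of "fst \<theta>" "snd \<theta>"] w
    by (simp add: p4_mult_vec smult_smult_assoc)
  finally show ?thesis .
qed

text \<open>A rank-one orthogonal projection has no eigenvalues other than 0 and 1, and the column
  spanning its range attains 1.\<close>

lemma max_eigenvalue_s4: "max_eigenvalue (s4 \<theta>) = 1"
proof -
  have dim: "dim_row (s4 \<theta>) = 4"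
    using s4_carrier by blast
  have "col4 \<theta> $ 3 \<noteq> 0" by (simp add: col4_def col2_def)
  then have "eigenvector (s4 \<theta>) (col4 \<theta>) 1"
    using weight_pos[of \<theta>] by (auto simp: eigenvector_def dim s4_mult_vec col4_scalar_prod)
  then have "eigenvalue (s4 \<theta>) 1"
    unfolding eigenvalue_def by blast
  moreover have "x = 0 \<or> x = 1" if ev: "eigenvalue (s4 \<theta>) (complex_of_real x)" for x
  proof -
    obtain v where v: "v \<in> carrier_vec 4" "v \<noteq> 0\<^sub>v 4" "s4 \<theta> *\<^sub>v v = complex_of_real x \<cdot>\<^sub>v v"
      using ev by (auto simp: eigenvalue_def eigenvector_def dim)
    let ?c = "(v \<bullet>c col4 \<theta>) / weight \<theta>"
    have eq: "?c \<cdot>\<^sub>v col4 \<theta> = complex_of_real x \<cdot>\<^sub>v v"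
      using v s4_mult_vec by metis
    \<comment> \<open>Pairing with the column keeps the coefficient of \<open>v\<close> along it,
      because projecting does not change that coefficient.\<close>
    have "(?c \<cdot>\<^sub>v col4 \<theta>) \<bullet>c col4 \<theta> = (complex_of_real x \<cdot>\<^sub>v v) \<bullet>c col4 \<theta>"
      using eq by simp
    then have "v \<bullet>c col4 \<theta> = x * (v \<bullet>c col4 \<theta>)"
      using v weight_pos[of \<theta>] by (simp add: col4_scalar_prod)
    then consider "x = 1" | "v \<bullet>c col4 \<theta> = 0" by auto
    then show ?thesis
    proof cases
      case 2
      then have zero: "complex_of_real x \<cdot>\<^sub>v v = 0\<^sub>v 4"
        unfolding eq[symmetric] by auto
      obtain i where "i < 4" "v $ i \<noteq> 0"
        using v by (metis carrier_vecD eq_vecI index_zero_vec)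
      then show ?thesis
        using arg_cong[OF zero, of "\<lambda>u. u $ i"] v by simp
    qed simp
  qed
  then have "{x. eigenvalue (s4 \<theta>) (complex_of_real x)} \<subseteq> {0, 1}" by blast
  ultimately show ?thesis
    unfolding max_eigenvalue_def
    by (intro Max_eqI) (auto intro: finite_subset)
qed

text \<open>At the origin \<open>e4\<close> spans the range of the projection and is therefore
  fixed.\<close>

lemma s4_zero_mult_e4: "s4 (0, 0) *\<^sub>v e4 = e4"
proof -
  have "weight (0, 0) = 64" "e4 \<bullet>c col4 (0, 0) = 16"
    by (simp_all add: weight_def sum_atLeast0_lessThan_4 scalar_prod_def e4_def col4_def col2_def)
  moreover have "col4 (0, 0) = 4 \<cdot>\<^sub>v e4"
    by (intro eq_vecI) (auto simp: e4_def col4_def col2_def)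
  moreover have "e4 \<in> carrier_vec 4" by (simp add: e4_def)
  ultimately show ?thesis
    by (simp add: s4_mult_vec smult_smult_assoc)
qed

section \<open>The matrix \<open>f_A\<close> near the origin\<close>

text \<open>Source of the Kronecker structure of \<open>f_A\<close>: with a = 1 + exp (i s), b = 1 +
  exp (i t) and M(z) the matrix with rows (1, cnj z) and (z, 1), three times
  \<open>f_A (s, t)\<close> is 9 I minus the Kronecker product of M(b) and M(a).\<close>

lemma phi_factor: "phi s t = (1 + exp (\<i> * s)) * (1 + exp (\<i> * t))"
proof -
  have "exp (\<i> * complex_of_real (s + t)) = exp (\<i> * s) * exp (\<i> * t)"
    by (simp add: exp_add[symmetric] distrib_left)
  then show ?thesis
    unfolding phi_def by (simp add: distrib_left distrib_right)
qed

lemma f_A_carrier [simp]: "f_A \<theta> \<in> carrier_mat 4 4"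
  by (cases \<theta>, intro carrier_matI) (simp_all add: f_A_def mat_of_rows_list_def)

lemma f_A_mult_vec_index:
  fixes s t :: real and v
  defines "a \<equiv> 1 + exp (\<i> * s)" and "b \<equiv> 1 + exp (\<i> * t)"
  assumes "v \<in> carrier_vec 4"
  shows "(f_A (s, t) *\<^sub>v v) $ 0 = (8 * v $ 0 - cnj a * v $ 1 - cnj b * v $ 2 - cnj a * cnj b * v $ 3) / 3"
    and "(f_A (s, t) *\<^sub>v v) $ 1 = (8 * v $ 1 - a * v $ 0 - a * cnj b * v $ 2 - cnj b * v $ 3) / 3"
    and "(f_A (s, t) *\<^sub>v v) $ 2 = (8 * v $ 2 - b * v $ 0 - cnj a * b * v $ 1 - cnj a * v $ 3) / 3"
    and "(f_A (s, t) *\<^sub>v v) $ 3 = (8 * v $ 3 - a * b * v $ 0 - b * v $ 1 - a * v $ 2) / 3"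
  using assms(3)
  by (simp_all add: f_A_def mat_of_rows_list_def scalar_prod_def sum_atLeast0_lessThan_4
      phi_factor a_def b_def cnj_exp_i diff_divide_distrib)

text \<open>Strict diagonal dominance: up to the factor 1/3, each row has diagonal entry 8 and
  off-diagonal entries of moduli r, q and r q. The row of a largest component of \<open>v\<close>
  then forces that component to vanish.\<close>

lemma f_A_nonsingular:
  fixes s t :: real
  defines "r \<equiv> cmod (1 + exp (\<i> * s))" and "q \<equiv> cmod (1 + exp (\<i> * t))"
  assumes dom: "r + q + r * q < 8" and v: "v \<in> carrier_vec 4" and zero: "f_A (s, t) *\<^sub>v v = 0\<^sub>v 4"
  shows "v = 0\<^sub>v 4"
proof -
  define a where "a = 1 + exp (\<i> * s)"
  define b where "b = 1 + exp (\<i> * t)"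
  have r: "cmod a = r" "cmod (cnj a) = r" and q: "cmod b = q" "cmod (cnj b) = q"
    by (simp_all only: a_def b_def r_def q_def complex_mod_cnj)
  define m where "m = Max ((\<lambda>i. cmod (v $ i)) ` {..<4})"
  have le: "cmod (v $ i) \<le> m" if "i < 4" for i
    unfolding m_def by (rule Max_ge) (use that in auto)
  have "m \<in> (\<lambda>i. cmod (v $ i)) ` {..<4}"
    unfolding m_def by (rule Max_in) (auto simp: lessThan_empty_iff)
  then obtain k where k: "k < 4" "m = cmod (v $ k)" by auto
  have row: "8 * cmod x \<le> (r + q + r * q) * m"
    if "8 * x = \<alpha> * y + \<beta> * z + \<gamma> * \<delta> * w" "cmod \<alpha> = r" "cmod \<beta> = q" "cmod \<gamma> = r" "cmod \<delta> = q"
      "cmod y \<le> m" "cmod z \<le> m" "cmod w \<le> m"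
    for x y z w \<alpha> \<beta> \<gamma> \<delta>
  proof -
    have "8 * cmod x = cmod (\<alpha> * y + \<beta> * z + \<gamma> * \<delta> * w)"
      using that(1) by (metis norm_mult norm_numeral)
    also have "\<dots> \<le> cmod (\<alpha> * y) + cmod (\<beta> * z) + cmod (\<gamma> * \<delta> * w)"
      by (intro norm_triangle_le add_right_mono norm_triangle_ineq)
    also have "\<dots> = r * cmod y + q * cmod z + r * q * cmod w"
      using that by (simp add: norm_mult)
    also have "\<dots> \<le> r * m + q * m + r * q * m"
      using that by (intro add_mono mult_left_mono) (auto simp: r_def q_def)
    finally show ?thesis by (simp add: algebra_simps)
  qed
  have comp: "(f_A (s, t) *\<^sub>v v) $ i = 0" if "i < 4" for i
    using that by (simp add: zero)
  \<comment> \<open>The terms are ordered by the moduli r, q, r q of their coefficients, so that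
    \<open>row\<close> covers all four equations.\<close>
  have eqs: "8 * v $ 0 = cnj a * v $ 1 + cnj b * v $ 2 + cnj a * cnj b * v $ 3"
    "8 * v $ 1 = a * v $ 0 + cnj b * v $ 3 + a * cnj b * v $ 2"
    "8 * v $ 2 = cnj a * v $ 3 + b * v $ 0 + cnj a * b * v $ 1"
    "8 * v $ 3 = a * v $ 2 + b * v $ 1 + a * b * v $ 0"
    using comp[of 0] comp[of 1] comp[of 2] comp[of 3]
    unfolding f_A_mult_vec_index[OF v] a_def[symmetric] b_def[symmetric]
    by (simp_all add: algebra_simps)
  have "8 * cmod (v $ i) \<le> (r + q + r * q) * m" if "i < 4" for i
    using that row[OF eqs(1)] row[OF eqs(2)] row[OF eqs(3)] row[OF eqs(4)] le[of 0] le[of 1] le[of 2] le[of 3]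
    by (auto simp: less_4_cases r q)
  with k have "8 * m \<le> (r + q + r * q) * m" by blast
  moreover have "0 \<le> m" using k by simp
  ultimately have "m = 0"
    using dom mult_strict_right_mono[of "r + q + r * q" 8 m] by linarith
  with le v show ?thesis
    by (intro eq_vecI) auto
qed

text \<open>Needed so that the minimum in \<open>min_eigenvalue\<close> is taken over a nonempty set. Up to
  scaling and shift, \<open>f_A\<close> is a Kronecker product of 2 by 2 matrices, whose eigenvectors are explicit.\<close>

lemma f_A_eigenvalue:
  fixes s t :: real
  defines "r \<equiv> cmod (1 + exp (\<i> * s))" and "q \<equiv> cmod (1 + exp (\<i> * t))"
  assumes nz: "r \<noteq> 0" "q \<noteq> 0"
  shows "eigenvalue (f_A (s, t)) (complex_of_real ((8 - r - q - r * q) / 3))"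
proof -
  define a where "a = 1 + exp (\<i> * s)"
  define b where "b = 1 + exp (\<i> * t)"
  have "cmod a = r" "cmod b = q"
    by (simp_all only: a_def b_def r_def q_def)
  then have r: "a * cnj a = complex_of_real r * r" and q: "b * cnj b = complex_of_real q * q"
    using complex_norm_square[of a] complex_norm_square[of b] by (simp_all add: power2_eq_square)
  have rr: "complex_of_real r * (r * x) = a * (cnj a * x)"
    and qq: "complex_of_real q * (q * x) = b * (cnj b * x)" for x :: complex
    by (simp_all only: r q mult.assoc[symmetric])
  \<comment> \<open>M(a) has the eigenvector (cnj a, r) with eigenvalue 1 + r, and likewise for b
    and q. The vector is the Kronecker product of (cnj b, q) and (cnj a, r), and its eigenvalue is
    (9 - (1 + r) (1 + q)) / 3.\<close>
  define v where "v = vec 4 (\<lambda>i. [cnj a * cnj b, r * cnj b, q * cnj a, complex_of_real r * q] ! i)"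
  have v: "v \<in> carrier_vec 4"
    by (simp add: v_def)
  have comps: "v $ 0 = cnj a * cnj b" "v $ 1 = r * cnj b" "v $ 2 = q * cnj a" "v $ 3 = complex_of_real r * q"
    by (simp_all add: v_def)
  have "cnj a * cnj b * (8 - r - q - complex_of_real r * q) = 8 * (cnj a * cnj b) - cnj a * (r * cnj b)
      - cnj b * (q * cnj a) - cnj a * cnj b * (complex_of_real r * q)"
    "r * cnj b * (8 - r - q - complex_of_real r * q) = 8 * (r * cnj b) - a * (cnj a * cnj b)
      - a * cnj b * (q * cnj a) - cnj b * (complex_of_real r * q)"
    "q * cnj a * (8 - r - q - complex_of_real r * q) = 8 * (q * cnj a) - b * (cnj a * cnj b)
      - cnj a * b * (r * cnj b) - cnj a * (complex_of_real r * q)"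
    "r * q * (8 - r - q - complex_of_real r * q) = 8 * (complex_of_real r * q) - a * b * (cnj a * cnj b)
      - b * (r * cnj b) - a * (q * cnj a)"
    by (simp_all add: algebra_simps r[symmetric] q[symmetric] rr qq)
  note eqs = this
  define c where "c = complex_of_real ((8 - r - q - r * q) / 3)"
  have "(f_A (s, t) *\<^sub>v v) $ 0 = c * v $ 0" "(f_A (s, t) *\<^sub>v v) $ 1 = c * v $ 1"
    "(f_A (s, t) *\<^sub>v v) $ 2 = c * v $ 2" "(f_A (s, t) *\<^sub>v v) $ 3 = c * v $ 3"
    unfolding f_A_mult_vec_index[OF v] a_def[symmetric] b_def[symmetric] comps eqs[symmetric] c_def
    by simp_all
  then have "(f_A (s, t) *\<^sub>v v) $ i = c * v $ i" if "i < 4" for i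
    using that less_4_cases by metis
  then have "f_A (s, t) *\<^sub>v v = c \<cdot>\<^sub>v v"
    using v carrier_matD[OF f_A_carrier[of "(s, t)"]]
    by (intro eq_vecI) (simp_all del: index_mult_mat_vec(1))
  moreover have "v \<noteq> 0\<^sub>v 4"
    using comps(4) nz by auto
  ultimately show ?thesis
    using v carrier_matD(1)[OF f_A_carrier[of "(s, t)"]]
    unfolding eigenvalue_def eigenvector_def c_def[symmetric] by metis
qed

text \<open>The bound 1 is below pi/2, so both cosines are positive and the moduli r and q are
  nonzero, as the explicit eigenvector requires. Away from the origin at least one of them is below
  2.\<close>

lemma min_eigenvalue_f_A_nonzero:
  assumes "\<theta> \<noteq> (0, 0)" "\<bar>fst \<theta>\<bar> < 1" "\<bar>snd \<theta>\<bar> < 1"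
  shows "min_eigenvalue (f_A \<theta>) \<noteq> 0"
proof -
  obtain s t where \<theta>: "\<theta> = (s, t)" by (cases \<theta>)
  define r where "r = cmod (1 + exp (\<i> * s))"
  define q where "q = cmod (1 + exp (\<i> * t))"
  have sq: "(cmod (1 + exp (\<i> * x)))\<^sup>2 = 2 + 2 * cos x" for x :: real
  proof -
    have "(cmod (1 + exp (\<i> * x)))\<^sup>2 = (1 + cos x)\<^sup>2 + (sin x)\<^sup>2"
      by (simp add: cmod_power2 cis_conv_exp[symmetric])
    then show ?thesis
      using sin_cos_squared_add[of x] by (simp add: power2_eq_square algebra_simps)
  qed
  have cos_lt: "cos x < 1" if "x \<noteq> 0" "\<bar>x\<bar> < 1" for x :: real
    using that cos_monotone_0_pi[of 0 "\<bar>x\<bar>"] pi_ge_two by simp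
  have le: "cmod (1 + exp (\<i> * x)) \<le> 2" for x :: real
    by (rule power2_le_imp_le) (simp_all add: sq)
  have lt: "cmod (1 + exp (\<i> * x)) < 2" if "x \<noteq> 0" "\<bar>x\<bar> < 1" for x :: real
    by (rule power2_less_imp_less) (use cos_lt[OF that] in \<open>simp_all add: sq\<close>)
  have nz: "cmod (1 + exp (\<i> * x)) \<noteq> 0" if "\<bar>x\<bar> < 1" for x :: real
  proof
    assume "cmod (1 + exp (\<i> * x)) = 0"
    with sq[of x] have "2 + 2 * cos x = 0" by simp
    moreover have "cos x > 0"
      by (rule cos_gt_zero_pi) (use that pi_ge_two in linarith)+
    ultimately show False by simp
  qed
  have "r \<noteq> 0" "q \<noteq> 0" "0 \<le> r" "0 \<le> q" "r \<le> 2" "q \<le> 2" "r < 2 \<or> q < 2"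
    using assms le lt nz by (auto simp: \<theta> r_def q_def)
  \<comment> \<open>Since 8 - r - q - r q = 9 - (1 + r) (1 + q), this is the dominance
    condition.\<close>
  then have "(1 + r) * (1 + q) < 3 * 3"
    using mult_less_le_imp_less[of "1 + r" 3 "1 + q" 3] mult_le_less_imp_less[of "1 + r" 3 "1 + q" 3] by auto
  then have dom: "r + q + r * q < 8" by (simp add: algebra_simps)
  have dim: "dim_row (f_A \<theta>) = 4"
    using f_A_carrier by blast
  let ?S = "{x. eigenvalue (f_A \<theta>) (complex_of_real x)}"
  \<comment> \<open>\<open>Min\<close> is an element of its set only if the set is finite and
    nonempty; finiteness comes from the spectrum, nonemptiness from
    \<open>f_A_eigenvalue\<close>.\<close>
  have "finite (complex_of_real ` ?S)"
    by (rule finite_subset[OF _ card_finite_spectrum(1)[OF f_A_carrier[of \<theta>]]]) (auto simp: spectrum_def)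
  then have "finite ?S"
    by (rule finite_imageD) (simp add: inj_on_def)
  moreover have "?S \<noteq> {}"
    using f_A_eigenvalue[of s t] \<open>r \<noteq> 0\<close> \<open>q \<noteq> 0\<close> unfolding \<theta> r_def q_def by blast
  ultimately have "min_eigenvalue (f_A \<theta>) \<in> ?S"
    unfolding min_eigenvalue_def by (rule Min_in)
  moreover have "0 \<notin> ?S"
  proof
    assume "0 \<in> ?S"
    then obtain v where v: "v \<in> carrier_vec 4" "v \<noteq> 0\<^sub>v 4" "f_A (s, t) *\<^sub>v v = 0 \<cdot>\<^sub>v v"
      by (auto simp: eigenvalue_def eigenvector_def dim \<theta>[symmetric])
    then have "f_A (s, t) *\<^sub>v v = 0\<^sub>v 4" by auto
    with f_A_nonsingular[of s t v] dom v show False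
      by (simp add: r_def q_def)
  qed
  ultimately show ?thesis by metis
qed

theorem theorem6:
  shows "(\<forall>\<theta> \<in> {0..<2 * pi} \<times> {0..<2 * pi}. positive_definite (p4_sum \<theta>))
    \<and> ((\<forall>\<theta> \<in> {0..<2 * pi} \<times> {0..<2 * pi}. invertible_mat (p4_sum \<theta>))
        \<and> s4 (0, 0) *\<^sub>v e4 = e4)
    \<and> (max_eigenvalue (s4 (0, 0)) = 1
        \<and> (\<forall>\<^sub>F \<theta> in at (0, 0). min_eigenvalue (f_A \<theta>) \<noteq> 0)
        \<and> (\<exists>c :: real.
            ((\<lambda>\<theta>. inverse (min_eigenvalue (f_A \<theta>)) * (1 - max_eigenvalue (s4 \<theta>))) \<longlongrightarrow> c) (at (0, 0))))"
proof (intro conjI)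
  have "\<forall>\<^sub>F \<theta> in at (0, 0). \<theta> \<in> ({-1<..<1} \<times> {-1<..<1} :: (real \<times> real) set) \<and> \<theta> \<noteq> (0, 0)"
    by (intro eventually_conj eventually_at_in_open' eventually_neq_at_within open_Times) auto
  then show "\<forall>\<^sub>F \<theta> in at (0, 0). min_eigenvalue (f_A \<theta>) \<noteq> 0"
    by eventually_elim (rule min_eigenvalue_f_A_nonzero; force)
  show "\<exists>c :: real.
      ((\<lambda>\<theta>. inverse (min_eigenvalue (f_A \<theta>)) * (1 - max_eigenvalue (s4 \<theta>))) \<longlongrightarrow> c) (at (0, 0))"
    \<comment> \<open>The second factor vanishes identically, so the product is constantly 0,
      whatever value \<open>inverse\<close> takes.\<close>
    by (intro exI[of _ 0]) (simp add: max_eigenvalue_s4)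
qed (simp_all add: positive_definite_p4_sum s4_zero_mult_e4 max_eigenvalue_s4
    positive_definite_invertible[OF p4_sum_carrier])

end
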